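(* There exists an instance of $R\,||\sum w_jC_j$ together with a local optimum $x$, with respect to the potentials $f_j$ with $\gamma=\frac{9+\sqrt5}{19}$, of the improved local search algorithm, whose approximation ratio is at least $1.791$, i.e. $C(x)\ge 1.791\cdot C(x^* )$, where $x^*$ is an optimal assignment of the instance (with $C(x^* )>0$).
   Context: $R\,||\sum w_jC_j$: a finite set $J$ of jobs with weights $w_j>0$, a finite set $M$ of machines, processing times $p_{ij}\in\mathbb R_{\ge0}\cup\{\infty\}$, and $\mathcal S_j=\{i\in M:p_{ij}<\infty\}\neq\emptyset$. Smith ratios: $\delta_{ij}=p_{ij}/w_j$. For each machine $i$, $\prec_i$ is a strict total order on $J$ such that $k\prec_i j$ implies $\delta_{ik}\le\delta_{ij}$ (ties broken consistently). An assignment is $x\in\{0,1\}^{M\times J}$ with $\sum_{i\in\mathcal S_j}x_{ij}=1$ and $x_{ij}=0$ for $i\notin\mathcal S_j$, for every $j\in J$. Completion times: $C_j(x)=\sum_{i\in M}x_{ij}\big(p_{ij}+\sum_{k\prec_i j}p_{ik}x_{ik}\big)$ (terms with a zero factor $x$ are $0$). Cost: $C(x)=\sum_{j\in J}w_jC_j(x)$. An optimal assignment minimizes $C$. Local search. For $\gamma=(9+\sqrt5)/19$ define for each job $j$ the potential $$f_j(x)=\sum_{i\in M}x_{ij}\Big(w_jp_{ij}+\gamma\sum_{k\ne j}w_jw_k\min\{\delta_{ij},\delta_{ik}\}\,x_{ik}\Big).$$ The algorithm moves a job $j$ to a different feasible machine when this strictly decreases $f_j$. A local optimum is an assignment $x$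 in which no job $j$ can strictly decrease $f_j$ by moving to another feasible machine (the other jobs staying fixed). *)

theory Defs
  imports Complex_Main "HOL-Library.Extended_Nonnegative_Real"
begin

text \<open>
  Processing times, potentials and costs take values in \<^typ>\<open>ennreal\<close>, where \<open>0 * \<infinity> = 0\<close>:
  a term with a zero assignment variable vanishes even if its processing time is infinite.
  The pair \<open>(k, j)\<close> is in \<open>prec I i\<close> iff job \<open>k\<close> precedes job \<open>j\<close> on machine \<open>i\<close>.
\<close>

record ('m, 'j) sched =
  jobs :: "'j set"
  machines :: "'m set"
  weight :: "'j \<Rightarrow> real"
  ptime :: "'m \<Rightarrow> 'j \<Rightarrow> ennreal"
  prec :: "'m \<Rightarrow> ('j \<times> 'j) set"

definition feasible_machines :: "('m, 'j) sched \<Rightarrow> 'j \<Rightarrow> 'm set" where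
  "feasible_machines I j = {i \<in> machines I. ptime I i j < \<infinity>}"

definition smith_ratio :: "('m, 'j) sched \<Rightarrow> 'm \<Rightarrow> 'j \<Rightarrow> ennreal" where
  "smith_ratio I i j = ptime I i j / ennreal (weight I j)"

definition sched_instance :: "('m, 'j) sched \<Rightarrow> bool" where
  "sched_instance I \<longleftrightarrow>
     finite (jobs I) \<and> finite (machines I) \<and>
     (\<forall>j\<in>jobs I. weight I j > 0) \<and>
     (\<forall>j\<in>jobs I. feasible_machines I j \<noteq> {}) \<and>
     (\<forall>i\<in>machines I.
        prec I i \<subseteq> jobs I \<times> jobs I \<and>
        strict_linear_order_on (jobs I) (prec I i) \<and>
        (\<forall>(k, j)\<in>prec I i. smith_ratio I i k \<le> smith_ratio I i j))"

text \<open>Values of an assignment outside \<open>machines I \<times> jobs I\<close> are unconstrained and never used.\<close>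

definition assignment :: "('m, 'j) sched \<Rightarrow> ('m \<Rightarrow> 'j \<Rightarrow> nat) \<Rightarrow> bool" where
  "assignment I x \<longleftrightarrow>
     (\<forall>i\<in>machines I. \<forall>j\<in>jobs I. x i j \<in> {0, 1}) \<and>
     (\<forall>j\<in>jobs I. (\<Sum>i\<in>feasible_machines I j. x i j) = 1 \<and>
        (\<forall>i\<in>machines I - feasible_machines I j. x i j = 0))"

definition completion_time :: "('m, 'j) sched \<Rightarrow> ('m \<Rightarrow> 'j \<Rightarrow> nat) \<Rightarrow> 'j \<Rightarrow> ennreal" where
  "completion_time I x j =
     (\<Sum>i\<in>machines I. of_nat (x i j) *
        (ptime I i j + (\<Sum>k\<in>{k \<in> jobs I. (k, j) \<in> prec I i}. ptime I i k * of_nat (x i k))))"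

definition cost :: "('m, 'j) sched \<Rightarrow> ('m \<Rightarrow> 'j \<Rightarrow> nat) \<Rightarrow> ennreal" where
  "cost I x = (\<Sum>j\<in>jobs I. ennreal (weight I j) * completion_time I x j)"

definition optimal_assignment :: "('m, 'j) sched \<Rightarrow> ('m \<Rightarrow> 'j \<Rightarrow> nat) \<Rightarrow> bool" where
  "optimal_assignment I x \<longleftrightarrow>
     assignment I x \<and> (\<forall>y. assignment I y \<longrightarrow> cost I x \<le> cost I y)"

definition potential :: "real \<Rightarrow> ('m, 'j) sched \<Rightarrow> 'j \<Rightarrow> ('m \<Rightarrow> 'j \<Rightarrow> nat) \<Rightarrow> ennreal" where
  "potential g I j x =
     (\<Sum>i\<in>machines I. of_nat (x i j) *
        (ennreal (weight I j) * ptime I i j +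
         ennreal g * (\<Sum>k\<in>jobs I - {j}.
           ennreal (weight I j) * ennreal (weight I k) *
           min (smith_ratio I i j) (smith_ratio I i k) * of_nat (x i k))))"

definition move_job :: "('m \<Rightarrow> 'j \<Rightarrow> nat) \<Rightarrow> 'j \<Rightarrow> 'm \<Rightarrow> 'm \<Rightarrow> 'j \<Rightarrow> nat" where
  "move_job x j i = (\<lambda>i' j'. if j' = j then (if i' = i then 1 else 0) else x i' j')"

definition local_optimum :: "real \<Rightarrow> ('m, 'j) sched \<Rightarrow> ('m \<Rightarrow> 'j \<Rightarrow> nat) \<Rightarrow> bool" where
  "local_optimum g I x \<longleftrightarrow>
     assignment I x \<and>
     (\<forall>j\<in>jobs I. \<forall>i\<in>feasible_machines I j. x i j = 0 \<longrightarrow>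
        \<not> potential g I j (move_job x j i) < potential g I j x)"

definition gamma_ls :: real where
  "gamma_ls = (9 + sqrt 5) / 19"

text \<open>Costs of assignments are finite, so comparing them in \<^typ>\<open>ennreal\<close> is comparing reals.\<close>

lemma cost_finite:
  assumes "sched_instance I" and "assignment I x"
  shows "cost I x < \<infinity>"
proof -
  have x0: "x i j = 0" if "i \<in> machines I" "j \<in> jobs I" "ptime I i j = \<infinity>" for i j
    using assms(2) that by (auto simp: assignment_def feasible_machines_def)
  have fin: "finite (jobs I)" "finite (machines I)"
    using assms(1) by (auto simp: sched_instance_def)
  have pt: "ptime I i j * of_nat (x i j) < \<infinity>" if "i \<in> machines I" "j \<in> jobs I" for i j
    using x0[OF that] by (cases "ptime I i j = \<infinity>")
      (auto simp: ennreal_mult_less_top less_top of_nat_less_top)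
  have "of_nat (x i j) *
        (ptime I i j + (\<Sum>k\<in>{k \<in> jobs I. (k, j) \<in> prec I i}. ptime I i k * of_nat (x i k))) < \<infinity>"
    if "i \<in> machines I" "j \<in> jobs I" for i j
  proof -
    have "(\<Sum>k\<in>{k \<in> jobs I. (k, j) \<in> prec I i}. ptime I i k * of_nat (x i k)) < \<infinity>"
      using pt[OF that(1)] fin by (simp add: less_top)
    then show ?thesis
      using pt[OF that] x0[OF that] by (cases "ptime I i j = \<infinity>")
        (auto simp: ennreal_mult_less_top less_top of_nat_less_top)
  qed
  then have "completion_time I x j < \<infinity>" if "j \<in> jobs I" for j
    unfolding completion_time_def using fin that by (simp add: less_top)
  then show ?thesis
    unfolding cost_def using fin by (simp add: less_top ennreal_mult_less_top ennreal_mult_eq_top_iff)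
qed

end

theory Submission
  imports Defs
begin

text \<open>
  Take a chain of jobs \<open>0, \<dots>, n - 1\<close> with geometrically growing weights \<open>b ^ j\<close>, where job \<open>j\<close> can
  run on machine \<open>j\<close> at weighted processing time \<open>1\<close> or on machine \<open>j + 1\<close> at weighted processing
  time \<open>1 / b\<^sup>2\<close>. If every job \<open>j\<close> sits on machine \<open>j\<close>, then moving it to machine \<open>j + 1\<close> makes it
  meet job \<open>j + 1\<close>, and its potential becomes \<open>1 / b\<^sup>2 + g / b\<close>. This is \<open>1\<close> if \<open>b\<close> is the positive
  root of \<open>b\<^sup>2 = 1 + g b\<close>, so the assignment is a local optimum of cost \<open>n\<close>. Only the last job must
  pay \<open>1\<close> on both of its machines, as nobody occupies machine \<open>n\<close>. Shifting all jobs costs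
  \<open>(n - 1) / b\<^sup>2 + 1\<close>, hence the ratio tends to \<open>b\<^sup>2\<close>, which is about \<open>1.79154\<close> for \<open>gamma_ls\<close>.
\<close>

section \<open>Optimal assignments\<close>

lemma cost_cong:
  assumes "\<And>i j. i \<in> machines I \<Longrightarrow> j \<in> jobs I \<Longrightarrow> x i j = y i j"
  shows "cost I x = cost I y"
  unfolding cost_def completion_time_def using assms
  by (intro sum.cong arg_cong2[where f = "(*)"] arg_cong2[where f = "(+)"] refl) auto

text \<open>Entries outside \<open>machines I \<times> jobs I\<close> are arbitrary, so there may be
  infinitely many assignments. The cost sees only the finitely many 0/1 entries inside, so a minimum
  is taken over the finite set of cost values.\<close>

lemma optimal_assignment_exists:
  assumes "sched_instance I" and "assignment I x0"
  shows "\<exists>x. optimal_assignment I x"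
proof -
  let ?K = "cost I ` {x. assignment I x}"
  have "?K \<subseteq> (\<lambda>S. cost I (\<lambda>i j. of_bool ((i, j) \<in> S))) ` Pow (machines I \<times> jobs I)"
  proof safe
    fix x assume x: "assignment I x"
    let ?S = "{(i, j) \<in> machines I \<times> jobs I. x i j = 1}"
    have "cost I x = cost I (\<lambda>i j. of_bool ((i, j) \<in> ?S))"
      using x by (intro cost_cong) (auto simp: assignment_def)
    then show "cost I x \<in> (\<lambda>S. cost I (\<lambda>i j. of_bool ((i, j) \<in> S))) ` Pow (machines I \<times> jobs I)"
      by (intro image_eqI[where x = ?S]) auto
  qed
  moreover have "finite (machines I \<times> jobs I)"
    using assms(1) by (simp add: sched_instance_def)
  ultimately have fin: "finite ?K"
    by (meson finite_Pow_iff finite_imageI finite_subset)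
  then have "Min ?K \<in> ?K"
    using assms(2) by (intro Min_in) auto
  then obtain x where "assignment I x" "cost I x = Min ?K"
    by auto
  with fin show ?thesis
    by (auto simp: optimal_assignment_def intro!: exI[of _ x])
qed

lemma cost_pos:
  assumes I: "sched_instance I" and x: "assignment I x" and j: "j \<in> jobs I"
    and pos: "\<And>i. i \<in> machines I \<Longrightarrow> ptime I i j > 0"
  shows "cost I x > 0"
proof -
  have fin: "finite (jobs I)" "finite (machines I)"
    using I by (auto simp: sched_instance_def)
  have "(\<Sum>i\<in>feasible_machines I j. x i j) = 1"
    using x j by (simp add: assignment_def)
  then have "\<exists>i\<in>feasible_machines I j. x i j \<noteq> 0"
    by (metis sum.neutral zero_neq_one)
  then obtain i where i: "i \<in> machines I" "x i j \<noteq> 0"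
    by (auto simp: feasible_machines_def)
  have "completion_time I x j \<noteq> 0"
    using i pos[OF i(1)] fin by (auto simp: completion_time_def)
  moreover have "weight I j > 0"
    using I j by (simp add: sched_instance_def)
  ultimately show ?thesis
    using fin j by (auto simp: cost_def zero_less_iff_neq_zero intro!: bexI[of _ j])
qed

section \<open>Assignments given by functions\<close>

text \<open>With this encoding a sum over machines collapses to one term and moving a job is a
  function update.\<close>

definition assign :: "('j \<Rightarrow> 'm) \<Rightarrow> 'm \<Rightarrow> 'j \<Rightarrow> nat" where
  "assign s i j = of_bool (i = s j)"

lemma sum_assign:
  fixes h :: "'m \<Rightarrow> ennreal"
  assumes "finite A" and "s j \<in> A"
  shows "(\<Sum>i\<in>A. of_nat (assign s i j) * h i) = h (s j)"
proof -
  have "(\<Sum>i\<in>A. of_nat (assign s i j) * h i) = (\<Sum>i\<in>A. if i = s j then h i else 0)"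
    by (intro sum.cong) (auto simp: assign_def)
  then show ?thesis
    using assms by simp
qed

lemma assignment_assign:
  assumes "finite (machines I)" and "\<And>j. j \<in> jobs I \<Longrightarrow> s j \<in> feasible_machines I j"
  shows "assignment I (assign s)"
proof -
  have "finite (feasible_machines I j)" for j
    using assms(1) by (simp add: feasible_machines_def)
  then have "(\<Sum>i\<in>feasible_machines I j. assign s i j) = 1" if "j \<in> jobs I" for j
    using assms(2)[OF that] by (simp add: assign_def of_bool_def)
  then show ?thesis
    using assms(2) by (auto simp: assignment_def assign_def)
qed

lemma move_job_assign: "move_job (assign s) j i = assign (s(j := i))"
  by (auto simp: move_job_def assign_def fun_eq_iff)

text \<open>No two jobs share a machine, and irreflexivity of the order keeps a job from waiting for
  itself, so all waiting times vanish.\<close>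

lemma cost_assign_inj:
  assumes I: "sched_instance I" and s: "\<And>j. j \<in> jobs I \<Longrightarrow> s j \<in> machines I"
    and inj: "inj_on s (jobs I)"
  shows "cost I (assign s) = (\<Sum>j\<in>jobs I. ennreal (weight I j) * ptime I (s j) j)"
proof -
  have "completion_time I (assign s) j = ptime I (s j) j" if j: "j \<in> jobs I" for j
  proof -
    have "irrefl (prec I (s j))"
      using I s[OF j] by (auto simp: sched_instance_def strict_linear_order_on_def)
    then have "assign s (s j) k = 0" if "k \<in> jobs I" "(k, j) \<in> prec I (s j)" for k
      using that inj j by (auto simp: assign_def irrefl_def inj_on_def)
    then have "(\<Sum>k\<in>{k \<in> jobs I. (k, j) \<in> prec I (s j)}. ptime I (s j) k * of_nat (assign s (s j) k)) = 0"
      by (intro sum.neutral) auto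
    then show ?thesis
      using I s[OF j] by (simp add: completion_time_def sum_assign sched_instance_def)
  qed
  then show ?thesis
    by (simp add: cost_def)
qed

lemma potential_assign:
  assumes "sched_instance I" and "s j \<in> machines I"
  shows "potential g I j (assign s) = ennreal (weight I j) * ptime I (s j) j +
     ennreal g * (\<Sum>k\<in>{k \<in> jobs I - {j}. s k = s j}. ennreal (weight I j) * ennreal (weight I k) *
           min (smith_ratio I (s j) j) (smith_ratio I (s j) k))"
proof -
  have "finite (jobs I)" "finite (machines I)"
    using assms(1) by (auto simp: sched_instance_def)
  then show ?thesis
    using assms(2) unfolding potential_def
    by (subst sum_assign)
      (auto simp: assign_def intro!: arg_cong2[where f = "(+)"] arg_cong2[where f = "(*)"] sum.mono_neutral_cong_right)
qed

section \<open>The chain instance\<close>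

text \<open>The branch \<open>i < n\<close> fails only for the last job on machine \<open>n\<close>.
  That machine stays empty, so for \<open>b > 1\<close> the cheap time would make the move
  profitable.\<close>

definition chain_ptime :: "real \<Rightarrow> nat \<Rightarrow> nat \<Rightarrow> nat \<Rightarrow> ennreal" where
  "chain_ptime b n i j =
     (if i = j then ennreal (1 / b ^ j)
      else if i = Suc j then ennreal (if i < n then 1 / b ^ (j + 2) else 1 / b ^ j)
      else \<infinity>)"

text \<open>The Smith ratio, stated ahead of the instance so that the field \<open>prec\<close> can
  refer to it.\<close>

definition chain_ratio :: "real \<Rightarrow> nat \<Rightarrow> nat \<Rightarrow> nat \<Rightarrow> ennreal" where
  "chain_ratio b n i j = chain_ptime b n i j / ennreal (b ^ j)"

text \<open>The index breaks ties, which do occur: jobs \<open>j\<close> and \<open>Suc j\<close>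
  have equal ratios on machine \<open>Suc j\<close> when \<open>Suc j < n\<close>, and all
  infeasible jobs have ratio \<open>\<infinity>\<close>.\<close>

definition chain :: "real \<Rightarrow> nat \<Rightarrow> (nat, nat) sched" where
  "chain b n = \<lparr>jobs = {..<n}, machines = {..n}, weight = (\<lambda>j. b ^ j), ptime = chain_ptime b n,
     prec = (\<lambda>i. {(k, j). k < n \<and> j < n \<and> (chain_ratio b n i k < chain_ratio b n i j \<or>
       chain_ratio b n i k = chain_ratio b n i j \<and> k < j)})\<rparr>"

lemma chain_simps [simp]:
  "jobs (chain b n) = {..<n}" "machines (chain b n) = {..n}" "weight (chain b n) j = b ^ j"
  "ptime (chain b n) = chain_ptime b n" "smith_ratio (chain b n) = chain_ratio b n"
  by (auto simp: chain_def smith_ratio_def chain_ratio_def fun_eq_iff)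

lemma feasible_machines_chain: "j < n \<Longrightarrow> feasible_machines (chain b n) j = {j, Suc j}"
  by (auto simp: feasible_machines_def chain_ptime_def split: if_splits)

lemma sched_instance_chain:
  assumes "b > 0"
  shows "sched_instance (chain b n)"
proof -
  have "strict_linear_order_on {..<n} (prec (chain b n) i)" for i
    unfolding strict_linear_order_on_def
  proof (intro conjI)
    show "trans (prec (chain b n) i)"
      by (rule transI) (auto simp: chain_def)
    show "irrefl (prec (chain b n) i)"
      by (auto simp: chain_def irrefl_def)
    show "total_on {..<n} (prec (chain b n) i)"
      by (auto simp: chain_def total_on_def)
  qed
  then show ?thesis
    using assms by (auto simp: sched_instance_def feasible_machines_chain) (auto simp: chain_def)
qed

lemma chain_weighted_ptime:
  assumes "b > 0"
  shows "ennreal (b ^ j) * chain_ptime b n j j = 1"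
    and "Suc j < n \<Longrightarrow> ennreal (b ^ j) * chain_ptime b n (Suc j) j = ennreal (1 / b\<^sup>2)"
    and "Suc j = n \<Longrightarrow> ennreal (b ^ j) * chain_ptime b n (Suc j) j = 1"
  using assms by (auto simp: chain_ptime_def ennreal_mult[symmetric] power_add power2_eq_square field_simps)

lemma assignment_chain:
  shows "assignment (chain b n) (assign (\<lambda>j. j))" and "assignment (chain b n) (assign Suc)"
  by (rule assignment_assign; simp add: feasible_machines_chain)+

lemma cost_chain_local:
  assumes "b > 0"
  shows "cost (chain b n) (assign (\<lambda>j. j)) = of_nat n"
  using assms by (subst cost_assign_inj) (auto simp: sched_instance_chain chain_weighted_ptime)

lemma cost_chain_shifted:
  assumes "b > 0"
  shows "cost (chain b (Suc m)) (assign Suc) = ennreal (real m / b\<^sup>2 + 1)"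
proof -
  have "cost (chain b (Suc m)) (assign Suc) = (\<Sum>j<m. ennreal (1 / b\<^sup>2)) + 1"
    using assms
    by (subst cost_assign_inj) (auto simp: sched_instance_chain chain_weighted_ptime)
  also have "\<dots> = ennreal (real m / b\<^sup>2 + 1)"
    by (subst sum_ennreal) (auto simp: ennreal_plus)
  finally show ?thesis .
qed

text \<open>Each job has a single alternative machine, and moving there leaves its potential at
  exactly 1. Equality suffices because only strict decreases count.\<close>

lemma local_optimum_chain:
  assumes b: "b > 0" and g: "g \<ge> 0" and root: "b\<^sup>2 = 1 + g * b"
  shows "local_optimum g (chain b n) (assign (\<lambda>j. j))"
proof -
  note I = sched_instance_chain[OF b]
  have "potential g (chain b n) j (assign (\<lambda>j. j)) \<le>
      potential g (chain b n) j (assign ((\<lambda>j. j)(j := Suc j)))" if j: "j < n" for j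
  proof -
    have "{k. k < n \<and> k \<noteq> j \<and> k = j} = {}"
      by auto
    then have stay: "potential g (chain b n) j (assign (\<lambda>j. j)) = 1"
      using j b by (subst potential_assign[OF I]) (auto simp: chain_weighted_ptime)
    let ?f = "\<lambda>k. ennreal (b ^ j) * ennreal (b ^ k) *
      min (chain_ratio b n (Suc j) j) (chain_ratio b n (Suc j) k)"
    have move: "potential g (chain b n) j (assign ((\<lambda>j. j)(j := Suc j))) =
        ennreal (b ^ j) * chain_ptime b n (Suc j) j +
        ennreal g * sum ?f {k \<in> {..<n} - {j}. k = Suc j}"
      using j by (subst potential_assign[OF I])
        (auto intro!: arg_cong2[where f = "(+)"] arg_cong2[where f = "(*)"] sum.cong)
    show ?thesis
    proof (cases "Suc j < n")
      case False
      then have "Suc j = n"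
        using j by simp
      then show ?thesis
        unfolding stay move using chain_weighted_ptime(3)[OF b, of j n] by simp
    next
      case True
      then have "{k \<in> {..<n} - {j}. k = Suc j} = {Suc j}"
        by auto
      \<comment> \<open>The times are tuned so that both jobs have the same ratio here; the minimum
        is this common value and the interaction term becomes \<open>1 / b\<close>.\<close>
      moreover have "chain_ratio b n (Suc j) k = ennreal (1 / b ^ (2 * j + 2))" if "k \<in> {j, Suc j}" for k
        using that True b
        by (auto simp: chain_ratio_def chain_ptime_def divide_ennreal power_add[symmetric] mult_2)
      ultimately have "sum ?f {k \<in> {..<n} - {j}. k = Suc j} =
          ennreal (b ^ j * b ^ Suc j * (1 / b ^ (2 * j + 2)))"
        using b by (simp add: ennreal_mult del: power_Suc times_divide_eq_right add_2_eq_Suc')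
      also have "b ^ j * b ^ Suc j * (1 / b ^ (2 * j + 2)) = 1 / b"
        using b by (simp add: power_add power_mult power2_eq_square field_simps power_mult_distrib)
      finally have "potential g (chain b n) j (assign ((\<lambda>j. j)(j := Suc j))) =
          ennreal (1 / b\<^sup>2 + g * (1 / b))"
        unfolding move using True b g chain_weighted_ptime(2)[OF b]
        by (simp add: ennreal_mult ennreal_plus del: times_divide_eq_right)
      also have "1 / b\<^sup>2 + g * (1 / b) = (1 + g * b) / b\<^sup>2"
        using b by (simp add: field_simps power2_eq_square)
      also have "\<dots> = 1"
        using b by (simp flip: root)
      finally show ?thesis
        unfolding stay by (simp only: ennreal_1 order_refl)
    qed
  qed
  then show ?thesis
    by (auto simp: local_optimum_def assignment_chain feasible_machines_chain move_job_assign
        assign_def[of "\<lambda>j. j"] not_less)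
qed

theorem theorem6p6:
  "\<exists>(I :: (nat, nat) sched) x xopt.
     sched_instance I \<and> local_optimum gamma_ls I x \<and> optimal_assignment I xopt \<and>
     cost I xopt > 0 \<and> cost I x \<ge> ennreal 1.791 * cost I xopt"
proof -
  define b where "b = (gamma_ls + sqrt (gamma_ls\<^sup>2 + 4)) / 2"
  \<comment> \<open>Rational lower bounds are carried from \<open>sqrt 5\<close> to
    \<open>b\<close>, precise enough that \<open>1.3384\<^sup>2 > 1.791\<close>.\<close>
  have "2.23603 \<le> sqrt 5"
    by (rule real_le_rsqrt) (simp add: power2_eq_square)
  then have g: "gamma_ls \<ge> 0.59137"
    by (simp add: gamma_ls_def)
  have "2.08543 \<le> sqrt (gamma_ls\<^sup>2 + 4)"
    using power_mono[OF g, of 2] by (intro real_le_rsqrt) (simp add: power2_eq_square)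
  then have b: "b \<ge> 1.3384"
    using g by (simp add: b_def)
  have root: "b\<^sup>2 = 1 + gamma_ls * b"
    by (simp add: b_def power2_eq_square field_simps)
  \<comment> \<open>The last job causes a deficit of \<open>0.791\<close>, while every other job
    gains \<open>1 - 1.791 / 1.3384\<^sup>2\<close>, about \<open>0.000175\<close>. Roughly 4500
    jobs recover it; 9999 leaves slack.\<close>
  define m :: nat where "m = 9999"
  let ?I = "chain b (Suc m)"
  have I: "sched_instance ?I"
    using b by (intro sched_instance_chain) simp
  obtain xopt where opt: "optimal_assignment ?I xopt"
    using optimal_assignment_exists[OF I assignment_chain(1)] by blast
  have "cost ?I xopt > 0"
    using I opt b by (intro cost_pos[where j = 0]) (auto simp: optimal_assignment_def chain_ptime_def)
  moreover have "ennreal 1.791 * cost ?I xopt \<le> cost ?I (assign (\<lambda>j. j))"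
  proof -
    \<comment> \<open>The optimum enters only through the upper bound given by the shifted
      schedule.\<close>
    have "cost ?I xopt \<le> cost ?I (assign Suc)"
      using opt assignment_chain(2) by (simp add: optimal_assignment_def)
    then have "ennreal 1.791 * cost ?I xopt \<le> ennreal 1.791 * ennreal (real m / b\<^sup>2 + 1)"
      using b by (intro mult_left_mono) (auto simp: cost_chain_shifted)
    also have "\<dots> = ennreal (1.791 * (real m / b\<^sup>2 + 1))"
      by (rule ennreal_mult[symmetric]) auto
    also have "\<dots> \<le> ennreal (real (Suc m))"
    proof (rule ennreal_leI)
      have "b\<^sup>2 \<ge> 1.3384\<^sup>2"
        using b by (intro power_mono) auto
      then have "real m / b\<^sup>2 \<le> real m / 1.3384\<^sup>2"
        using b by (intro divide_left_mono mult_pos_pos zero_less_power) auto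
      then show "1.791 * (real m / b\<^sup>2 + 1) \<le> real (Suc m)"
        by (simp add: m_def power2_eq_square)
    qed
    also have "\<dots> = cost ?I (assign (\<lambda>j. j))"
      using b by (subst cost_chain_local) (auto simp: ennreal_of_nat_eq_real_of_nat)
    finally show ?thesis .
  qed
  moreover have "local_optimum gamma_ls ?I (assign (\<lambda>j. j))"
    using b g root by (intro local_optimum_chain) auto
  ultimately show ?thesis
    using I opt by blast
qed

end
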